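(* For each real number $\alpha\in\bigl(0,1/(2h)\bigr)$ and each integer $h\geq 1$, there exist a constant $c>0$ and a sequence of graphs $\{G^{*}_{n;\alpha}\}_{n\in h\mathbb{N}}$, where $G^{*}_{n;\alpha}$ is a balanced bipartite graph on $2n$ vertices with minimum degree $\delta(G^{*}_{n;\alpha})\geq \alpha n$, such that if $p\leq c\,n^{-(2h-1)/h^2}$ then with high probability $G^{*}_{n;\alpha}\cup G_{n,n,p}$ does not contain a perfect $K_{h,h}$-tiling.
   Context: An $H$-tiling of a graph $G$ is a collection of vertex-disjoint copies of $H$ in $G$; it is perfect if it covers all vertices of $G$. A balanced bipartite graph on $2n$ vertices has parts $A,B$ with $|A|=|B|=n$. $G_{n,n,p}$ is the random bipartite graph on the same bipartition $(A,B)$ as $G^{*}_{n;\alpha}$ in which each pair $\{a,b\}$, $a\in A$, $b\in B$, is an edge independently with probability $p$; the union is taken on the common vertex set $A\cup B$. "With high probability" means with probability tending to $1$ as $n\to\infty$. *)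

theory Defs
  imports "HOL-Probability.Probability"
begin

record 'a ugraph =
  verts :: "'a set"
  edges :: "'a set set"

definition simple_graph :: "'a ugraph \<Rightarrow> bool" where
  "simple_graph G \<longleftrightarrow> finite (verts G) \<and> (\<forall>e\<in>edges G. e \<subseteq> verts G \<and> card e = 2)"

definition subgraph :: "'a ugraph \<Rightarrow> 'a ugraph \<Rightarrow> bool" where
  "subgraph F G \<longleftrightarrow> simple_graph F \<and> verts F \<subseteq> verts G \<and> edges F \<subseteq> edges G"

definition graph_iso :: "'a ugraph \<Rightarrow> 'b ugraph \<Rightarrow> bool" where
  "graph_iso G H \<longleftrightarrow>
     (\<exists>f. bij_betw f (verts G) (verts H) \<and> (\<lambda>e. f ` e) ` edges G = edges H)"

definition graph_union :: "'a ugraph \<Rightarrow> 'a ugraph \<Rightarrow> 'a ugraph" where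
  "graph_union G H = \<lparr>verts = verts G \<union> verts H, edges = edges G \<union> edges H\<rparr>"

definition graph_degree :: "'a ugraph \<Rightarrow> 'a \<Rightarrow> nat" where
  "graph_degree G v = card {e \<in> edges G. v \<in> e}"

text \<open>Meaningful for finite graphs with at least one vertex.\<close>

definition min_degree :: "'a ugraph \<Rightarrow> nat" where
  "min_degree G = Min (graph_degree G ` verts G)"

definition balanced_bipartite :: "'a ugraph \<Rightarrow> 'a set \<Rightarrow> 'a set \<Rightarrow> nat \<Rightarrow> bool" where
  "balanced_bipartite G A B n \<longleftrightarrow>
     simple_graph G \<and> finite A \<and> finite B \<and> card A = n \<and> card B = n \<and>
     A \<inter> B = {} \<and> verts G = A \<union> B \<and>
     (\<forall>e\<in>edges G. \<exists>a\<in>A. \<exists>b\<in>B. e = {a, b})"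

definition complete_bipartite :: "nat \<Rightarrow> nat \<Rightarrow> (nat + nat) ugraph" where
  "complete_bipartite s t =
     \<lparr>verts = Inl ` {..<s} \<union> Inr ` {..<t},
      edges = {{Inl i, Inr j} | i j. i < s \<and> j < t}\<rparr>"

text \<open>Copies are subgraphs, not necessarily induced.\<close>

definition tiling :: "'b ugraph \<Rightarrow> 'a ugraph \<Rightarrow> 'a ugraph set \<Rightarrow> bool" where
  "tiling H G T \<longleftrightarrow>
     (\<forall>F\<in>T. subgraph F G \<and> graph_iso H F) \<and>
     (\<forall>F\<in>T. \<forall>F'\<in>T. F \<noteq> F' \<longrightarrow> verts F \<inter> verts F' = {})"

definition perfect_tiling :: "'b ugraph \<Rightarrow> 'a ugraph \<Rightarrow> 'a ugraph set \<Rightarrow> bool" where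
  "perfect_tiling H G T \<longleftrightarrow> tiling H G T \<and> (\<Union>F\<in>T. verts F) = verts G"

text \<open>
  The random bipartite graph on parts \<open>A\<close>, \<open>B\<close>: one independent Bernoulli variable for
  each pair in \<open>A \<times> B\<close>. Intended for disjoint finite \<open>A\<close>, \<open>B\<close> and \<open>p\<close> in the unit interval.
\<close>

definition random_bipartite :: "'a set \<Rightarrow> 'a set \<Rightarrow> real \<Rightarrow> 'a ugraph pmf" where
  "random_bipartite A B p =
     map_pmf (\<lambda>X. \<lparr>verts = A \<union> B, edges = {{a, b} | a b. a \<in> A \<and> b \<in> B \<and> X (a, b)}\<rparr>)
       (Pi_pmf (A \<times> B) False (\<lambda>_. bernoulli_pmf p))"

end

theory Submission
  imports Defs
begin

text \<open>
  In the host graph, sets \<open>A\<^sub>0\<close> and \<open>B\<^sub>0\<close> of \<open>m = \<lceil>\<alpha> n\<rceil>\<close> vertices are joined to the whole opposite part,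
  and there are no other edges. A perfect tiling has \<open>n / h\<close> tiles, at most \<open>2 m\<close> of which meet
  \<open>A\<^sub>0 \<union> B\<^sub>0\<close>; as \<open>\<alpha> < 1 / (2 h)\<close>, linearly many disjoint tiles consist of random edges only.
  A first moment bound on the number of copies of \<open>K\<^bsub>h,h\<^esub>\<close> would only give a constant failure
  probability, so the union bound is taken over \<open>k\<close>-sets of disjoint copies: their expected number
  is at most \<open>(n\<^bsup>2h\<^esup> p\<^bsup>h*h\<^esup>)\<^bsup>k\<^esup> / k! \<le> (e c n / k)\<^bsup>k\<^esup>\<close>, which is exponentially small
  for \<open>k\<close> linear in \<open>n\<close> and \<open>c\<close> small.
\<close>

section \<open>Union bound for independent Bernoulli variables; a lower bound on factorials\<close>

lemma prob_Pi_pmf_bernoulli_all: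
  assumes "finite I" "S \<subseteq> I" "0 \<le> p" "p \<le> 1"
  shows "measure_pmf.prob (Pi_pmf I False (\<lambda>_. bernoulli_pmf p)) {X. \<forall>x\<in>S. X x} = p ^ card S"
proof -
  have "{X. \<forall>x\<in>S. X x} = Pi I (\<lambda>x. if x \<in> S then {True} else UNIV)"
    using assms by (auto simp: Pi_def split: if_splits)
  then have "measure_pmf.prob (Pi_pmf I False (\<lambda>_. bernoulli_pmf p)) {X. \<forall>x\<in>S. X x}
      = (\<Prod>x\<in>I. if x \<in> S then p else 1)"
    using assms
    by (simp add: measure_Pi_pmf_Pi if_distrib[of "measure_pmf.prob (bernoulli_pmf p)"] measure_pmf_single cong: if_cong)
  also have "\<dots> = (\<Prod>x\<in>I \<inter> S. p)"
    using assms by (subst prod.inter_restrict) auto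
  finally show ?thesis
    using assms by (simp add: Int_absorb1)
qed

text \<open>The union bound. The members of \<open>\<S>\<close> will be the sets of vertex pairs
  required by \<open>k\<close> disjoint copies, so that \<open>s\<close> becomes
  \<open>h * h * k\<close>.\<close>

lemma prob_Pi_pmf_bernoulli_ex_all_le:
  assumes "finite I" "finite \<S>" "\<And>S. S \<in> \<S> \<Longrightarrow> S \<subseteq> I \<and> card S = s" "0 \<le> p" "p \<le> 1"
  shows "measure_pmf.prob (Pi_pmf I False (\<lambda>_. bernoulli_pmf p)) {X. \<exists>S\<in>\<S>. \<forall>x\<in>S. X x}
    \<le> real (card \<S>) * p ^ s"
proof -
  let ?M = "Pi_pmf I False (\<lambda>_. bernoulli_pmf p)"
  have "{X. \<exists>S\<in>\<S>. \<forall>x\<in>S. X x} = (\<Union>S\<in>\<S>. {X. \<forall>x\<in>S. X x})" by blast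
  then have "measure_pmf.prob ?M {X. \<exists>S\<in>\<S>. \<forall>x\<in>S. X x}
      \<le> (\<Sum>S\<in>\<S>. measure_pmf.prob ?M {X. \<forall>x\<in>S. X x})"
    using measure_pmf.finite_measure_subadditive_finite[OF assms(2), of "\<lambda>S. {X. \<forall>x\<in>S. X x}" ?M]
    by simp
  also have "\<dots> = (\<Sum>S\<in>\<S>. p ^ s)"
  proof (rule sum.cong)
    fix S assume "S \<in> \<S>"
    with assms(3) have "S \<subseteq> I" "card S = s" by blast+
    then show "measure_pmf.prob ?M {X. \<forall>x\<in>S. X x} = p ^ s"
      using assms(1,4,5) by (simp add: prob_Pi_pmf_bernoulli_all)
  qed simp
  finally show ?thesis by simp
qed

text \<open>The quotient \<open>k^k / k!\<close> is a single term of the exponential series of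
  \<open>exp k\<close>, all of whose terms are nonnegative. This is the weak Stirling bound
  \<open>k! \<ge> (k / e)^k\<close>.\<close>

lemma power_self_le_exp_fact: "real k ^ k \<le> exp 1 ^ k * fact k"
proof -
  have "real k ^ k /\<^sub>R fact k \<le> (\<Sum>i. real k ^ i /\<^sub>R fact i)"
    using sum_le_suminf[OF summable_exp_generic[of "real k"], of "{k}"] by simp
  then have "real k ^ k / fact k \<le> exp (real k)"
    by (simp add: exp_def divide_inverse mult.commute)
  then show ?thesis
    by (simp add: field_simps exp_of_nat_mult[of k 1, simplified])
qed

section \<open>Copies of \<open>K_{h,h}\<close> in a bipartite graph, and tiles avoiding a small
  vertex set\<close>

text \<open>Since \<open>K_{h,h}\<close> is connected, its proper 2-colouring is unique up to
  swapping the colours. Hence the two classes of a copy are its traces on \<open>A\<close> and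
  \<open>B\<close>, in one order or the other.\<close>

lemma complete_bipartite_copy:
  assumes iso: "graph_iso (complete_bipartite h h) F" and "h \<ge> 1" and "A \<inter> B = {}"
    and edges: "\<And>e. e \<in> edges F \<Longrightarrow> \<exists>a\<in>A. \<exists>b\<in>B. e = {a, b}"
  shows "card (verts F \<inter> A) = h" "card (verts F \<inter> B) = h"
    "\<And>a b. a \<in> verts F \<inter> A \<Longrightarrow> b \<in> verts F \<inter> B \<Longrightarrow> {a, b} \<in> edges F"
proof -
  obtain f where f: "bij_betw f (verts (complete_bipartite h h)) (verts F)"
    and fe: "(\<lambda>e. f ` e) ` edges (complete_bipartite h h) = edges F"
    using iso by (auto simp: graph_iso_def)
  define X where "X = (\<lambda>i. f (Inl i)) ` {..<h}"
  define Y where "Y = (\<lambda>i. f (Inr i)) ` {..<h}"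
  have V: "verts F = X \<union> Y"
    using f by (auto simp: bij_betw_def complete_bipartite_def X_def Y_def)
  have inj: "inj_on f (Inl ` {..<h} \<union> Inr ` {..<h})"
    using f by (auto simp: bij_betw_def complete_bipartite_def)
  have "card X = h" unfolding X_def
    by (subst card_image) (use inj in \<open>auto simp: inj_on_def\<close>)
  have "card Y = h" unfolding Y_def
    by (subst card_image) (use inj in \<open>auto simp: inj_on_def\<close>)
  have E: "{x, y} \<in> edges F" if "x \<in> X" "y \<in> Y" for x y
  proof -
    from that obtain i j where ij: "x = f (Inl i)" "y = f (Inr j)" "i < h" "j < h"
      by (auto simp: X_def Y_def)
    then have "{Inl i, Inr j} \<in> edges (complete_bipartite h h)"
      by (auto simp: complete_bipartite_def)
    then have "f ` {Inl i, Inr j} \<in> edges F" unfolding fe[symmetric] by (rule imageI)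
    then show ?thesis by (simp add: ij)
  qed
  have side: "x \<in> A \<and> y \<in> B \<or> x \<in> B \<and> y \<in> A" if "x \<in> X" "y \<in> Y" for x y
    using edges[OF E[OF that]] by (auto simp: doubleton_eq_iff)
  obtain x0 y0 where x0: "x0 \<in> X" and y0: "y0 \<in> Y"
    using \<open>h \<ge> 1\<close> \<open>card X = h\<close> \<open>card Y = h\<close> by (metis card.empty equals0I not_one_le_zero)
  \<comment> \<open>As \<open>x0\<close> is adjacent to all of \<open>Y\<close>, its position
    decides the part containing \<open>Y\<close>; the vertex \<open>y0\<close> then decides the part
    containing \<open>X\<close>.\<close>
  have "X \<subseteq> A \<and> Y \<subseteq> B \<or> X \<subseteq> B \<and> Y \<subseteq> A"
  proof (cases "x0 \<in> A")
    case True
    then have "Y \<subseteq> B" using side[OF x0] \<open>A \<inter> B = {}\<close> by blast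
    moreover from this have "X \<subseteq> A" using side[OF _ y0] y0 \<open>A \<inter> B = {}\<close> by blast
    ultimately show ?thesis by blast
  next
    case False
    then have "Y \<subseteq> A" using side[OF x0] by blast
    moreover from this have "X \<subseteq> B" using side[OF _ y0] y0 \<open>A \<inter> B = {}\<close> by blast
    ultimately show ?thesis by blast
  qed
  then consider "X \<subseteq> A" "Y \<subseteq> B" "verts F \<inter> A = X" "verts F \<inter> B = Y"
    | "X \<subseteq> B" "Y \<subseteq> A" "verts F \<inter> A = Y" "verts F \<inter> B = X"
    using V \<open>A \<inter> B = {}\<close> by blast
  note XY = this
  show "card (verts F \<inter> A) = h"
    by (cases rule: XY) (simp_all add: \<open>card X = h\<close> \<open>card Y = h\<close>)
  show "card (verts F \<inter> B) = h"
    by (cases rule: XY) (simp_all add: \<open>card X = h\<close> \<open>card Y = h\<close>)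
  show "{a, b} \<in> edges F" if "a \<in> verts F \<inter> A" "b \<in> verts F \<inter> B" for a b
  proof (cases rule: XY)
    case 1
    with that show ?thesis by (intro E) simp_all
  next
    case 2
    with that have "{b, a} \<in> edges F" by (intro E) simp_all
    then show ?thesis by (simp add: insert_commute)
  qed
qed

text \<open>Every tile has exactly \<open>h\<close> vertices in \<open>A\<close>, so there are
  \<open>n / h\<close> tiles. Disjoint tiles that meet \<open>Z\<close> contain different vertices
  of \<open>Z\<close>, so at most \<open>2 * m\<close> tiles are lost.\<close>

lemma card_tiles_avoiding_ge:
  assumes tiling: "perfect_tiling (complete_bipartite h h) H T" and "h \<ge> 1"
    and H: "balanced_bipartite H A B n" and Z: "finite Z" "card Z \<le> 2 * m"
    and k: "h * (k + 2 * m) \<le> n"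
  shows "\<exists>T'\<subseteq>T. card T' = k \<and> (\<forall>F\<in>T'. verts F \<inter> Z = {})"
proof -
  have copy: "subgraph F H" "graph_iso (complete_bipartite h h) F" if "F \<in> T" for F
    using that tiling by (auto simp: perfect_tiling_def tiling_def)
  have disj: "verts F \<inter> verts F' = {}" if "F \<in> T" "F' \<in> T" "F \<noteq> F'" for F F'
    using that tiling by (auto simp: perfect_tiling_def tiling_def)
  have V: "(\<Union>F\<in>T. verts F) = A \<union> B" "finite A" "finite B" "A \<inter> B = {}" "card A = n"
    using tiling H by (auto simp: perfect_tiling_def balanced_bipartite_def)
  have cardA: "card (verts F \<inter> A) = h" if "F \<in> T" for F
  proof (rule complete_bipartite_copy(1))
    fix e assume "e \<in> edges F"
    with copy(1)[OF that] have "e \<in> edges H" by (auto simp: subgraph_def)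
    with H show "\<exists>a\<in>A. \<exists>b\<in>B. e = {a, b}" by (auto simp: balanced_bipartite_def)
  qed (use copy[OF that] \<open>h \<ge> 1\<close> V in auto)
  have ne: "verts F \<inter> A \<noteq> {}" if "F \<in> T" for F
    using cardA[OF that] \<open>h \<ge> 1\<close> by auto
  \<comment> \<open>Finiteness of \<open>T\<close> has to be derived: pairwise disjoint nonempty
    vertex sets are distinct, so \<open>verts\<close> embeds \<open>T\<close> into the finite power
    set of \<open>A \<union> B\<close>.\<close>
  have "inj_on verts T"
    using disj ne by (fastforce intro!: inj_onI)
  moreover have "finite (verts ` T)"
    by (rule finite_subset[of _ "Pow (A \<union> B)"]) (use V in auto)
  ultimately have "finite T" by (simp add: finite_image_iff)
  have "(\<Union>F\<in>T. verts F \<inter> A) = A" using V(1) by blast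
  with V(5) have "n = card (\<Union>F\<in>T. verts F \<inter> A)" by simp
  also have "\<dots> = (\<Sum>F\<in>T. card (verts F \<inter> A))"
    using \<open>finite T\<close> V disj by (intro card_UN_disjoint) blast+
  also have "\<dots> = h * card T" using cardA by simp
  finally have n: "n = h * card T" .
  define T1 where "T1 = {F \<in> T. verts F \<inter> Z \<noteq> {}}"
  have "\<forall>F\<in>T1. \<exists>v. v \<in> verts F \<inter> Z" by (auto simp: T1_def)
  then obtain g where g: "\<forall>F\<in>T1. g F \<in> verts F \<inter> Z" by metis
  have "inj_on g T1"
  proof (rule inj_onI)
    fix F F' assume "F \<in> T1" "F' \<in> T1" "g F = g F'"
    with g have "g F \<in> verts F \<inter> verts F'" by auto
    with disj[of F F'] \<open>F \<in> T1\<close> \<open>F' \<in> T1\<close> show "F = F'" by (auto simp: T1_def)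
  qed
  then have "card T1 \<le> card Z"
    by (rule card_inj_on_le) (use g Z in auto)
  moreover have "card (T - T1) = card T - card T1"
    by (rule card_Diff_subset) (use \<open>finite T\<close> in \<open>auto simp: T1_def\<close>)
  moreover have "k + 2 * m \<le> card T"
    using k \<open>h \<ge> 1\<close> by (simp add: n)
  ultimately have "k \<le> card (T - T1)" using Z by simp
  then obtain T' where "T' \<subseteq> T - T1" "card T' = k"
    using obtain_subset_with_card_n by metis
  then show ?thesis by (auto simp: T1_def)
qed

section \<open>The host graph and its minimum degree\<close>

lemma balanced_bipartiteI:
  assumes "finite A" "finite B" "card A = n" "card B = n" "A \<inter> B = {}" "verts G = A \<union> B"
    and edges: "\<And>e. e \<in> edges G \<Longrightarrow> \<exists>a\<in>A. \<exists>b\<in>B. e = {a, b}"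
  shows "balanced_bipartite G A B n"
proof -
  have "e \<subseteq> verts G \<and> card e = 2" if e: "e \<in> edges G" for e
  proof -
    obtain a b where ab: "a \<in> A" "b \<in> B" "e = {a, b}" using edges[OF e] by blast
    with \<open>A \<inter> B = {}\<close> have "a \<noteq> b" by blast
    with ab \<open>verts G = A \<union> B\<close> show ?thesis by simp
  qed
  then show ?thesis using assms by (simp add: balanced_bipartite_def simple_graph_def)
qed

lemma balanced_bipartite_graph_union:
  assumes "balanced_bipartite G A B n" "balanced_bipartite H A B n"
  shows "balanced_bipartite (graph_union G H) A B n"
proof (rule balanced_bipartiteI)
  fix e assume "e \<in> edges (graph_union G H)"
  then consider "e \<in> edges G" | "e \<in> edges H" by (auto simp: graph_union_def)
  then show "\<exists>a\<in>A. \<exists>b\<in>B. e = {a, b}"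
    using assms unfolding balanced_bipartite_def by cases blast+
qed (use assms in \<open>simp_all add: balanced_bipartite_def graph_union_def\<close>)

text \<open>The initial segments \<open>{..<m}\<close> and \<open>{n..<n + m}\<close> of the two
  parts play the roles of \<open>A_0\<close> and \<open>B_0\<close>. Together they form a vertex
  cover of at most \<open>2 * m\<close> vertices, which limits how many disjoint tiles can use a
  host edge.\<close>

definition dominated_bipartite :: "nat \<Rightarrow> nat \<Rightarrow> nat ugraph" where
  "dominated_bipartite n m = \<lparr>verts = {..<n} \<union> {n..<2 * n},
     edges = {{a, b} | a b. a \<in> {..<n} \<and> b \<in> {n..<2 * n} \<and> (a < m \<or> b < n + m)}\<rparr>"

lemma balanced_bipartite_dominated_bipartite:
  "balanced_bipartite (dominated_bipartite n m) {..<n} {n..<2 * n} n"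
proof (rule balanced_bipartiteI)
  fix e assume "e \<in> edges (dominated_bipartite n m)"
  then show "\<exists>a\<in>{..<n}. \<exists>b\<in>{n..<2 * n}. e = {a, b}"
    unfolding dominated_bipartite_def by force
qed (auto simp: dominated_bipartite_def)

lemma min_degree_dominated_bipartite:
  assumes "n > 0" "m \<le> n"
  shows "min_degree (dominated_bipartite n m) \<ge> m"
proof -
  have fin: "finite (edges (dominated_bipartite n m))"
    by (rule finite_subset[of _ "Pow {..<2 * n}"]) (auto simp: dominated_bipartite_def)
  have "m \<le> graph_degree (dominated_bipartite n m) v" if "v \<in> verts (dominated_bipartite n m)" for v
  proof -
    \<comment> \<open>The \<open>m\<close> distinguished vertices opposite to \<open>v\<close>, all
      of them neighbours of \<open>v\<close>. The assumption \<open>m \<le> n\<close> keeps them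
      inside the opposite part.\<close>
    define S where "S = (if v < n then {n..<n + m} else {..<m})"
    have "m = card ((\<lambda>w. {v, w}) ` S)"
      by (subst card_image) (auto simp: S_def inj_on_def doubleton_eq_iff)
    also have "\<dots> \<le> graph_degree (dominated_bipartite n m) v"
      unfolding graph_degree_def
    proof (rule card_mono)
      show "(\<lambda>w. {v, w}) ` S \<subseteq> {e \<in> edges (dominated_bipartite n m). v \<in> e}"
      proof (cases "v < n")
        case True
        have "{v, w} \<in> edges (dominated_bipartite n m)" if "w \<in> {n..<n + m}" for w
          unfolding dominated_bipartite_def ugraph.simps mem_Collect_eq
          by (rule exI[of _ v], rule exI[of _ w]) (use True that assms in auto)
        with True show ?thesis by (auto simp: S_def)
      next
        case False
        have "{v, w} \<in> edges (dominated_bipartite n m)" if "w < m" for w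
          unfolding dominated_bipartite_def ugraph.simps mem_Collect_eq
          by (rule exI[of _ w], rule exI[of _ v])
            (use False that assms \<open>v \<in> verts _\<close> in \<open>auto simp: dominated_bipartite_def insert_commute\<close>)
        with False show ?thesis by (auto simp: S_def)
      qed
    qed (use fin in simp)
    finally show ?thesis .
  qed
  moreover have "finite (verts (dominated_bipartite n m))" "verts (dominated_bipartite n m) \<noteq> {}"
    using assms by (auto simp: dominated_bipartite_def)
  ultimately show ?thesis by (simp add: min_degree_def)
qed


section \<open>From a perfect tiling to disjoint random copies, and the union bound over
  them\<close>

text \<open>Tiles that avoid the vertex cover \<open>Z\<close> of \<open>G\<close> have all their
  edges in \<open>R\<close>. A tile is recorded by its traces on \<open>A\<close> and
  \<open>B\<close>. Disjointness of the traces on \<open>A\<close> is what is kept: it makes the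
  products \<open>fst q \<times> snd q\<close> disjoint, so different copies depend on different
  random pairs.\<close>

lemma perfect_tiling_imp_disjoint_copies:
  fixes G R :: "'a ugraph"
  assumes T: "perfect_tiling (complete_bipartite h h) (graph_union G R) T" and "h \<ge> 1"
    and G: "balanced_bipartite G A B n" and R: "balanced_bipartite R A B n"
    and Z: "finite Z" "card Z \<le> 2 * m" and dom: "\<And>e. e \<in> edges G \<Longrightarrow> e \<inter> Z \<noteq> {}"
    and k: "h * (k + 2 * m) \<le> n"
  obtains K where "K \<subseteq> {X. X \<subseteq> A \<and> card X = h} \<times> {Y. Y \<subseteq> B \<and> card Y = h}" "card K = k"
    "\<forall>q\<in>K. \<forall>q'\<in>K. q \<noteq> q' \<longrightarrow> fst q \<inter> fst q' = {}"
    "\<And>q a b. q \<in> K \<Longrightarrow> a \<in> fst q \<Longrightarrow> b \<in> snd q \<Longrightarrow> {a, b} \<in> edges R"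
proof -
  have GR: "balanced_bipartite (graph_union G R) A B n"
    using G R by (rule balanced_bipartite_graph_union)
  then have AB: "A \<inter> B = {}" by (simp add: balanced_bipartite_def)
  obtain T' where T': "T' \<subseteq> T" "card T' = k" "\<And>F. F \<in> T' \<Longrightarrow> verts F \<inter> Z = {}"
    using card_tiles_avoiding_ge[OF T \<open>h \<ge> 1\<close> GR Z k] by blast
  have F: "subgraph F (graph_union G R)" "graph_iso (complete_bipartite h h) F" if "F \<in> T'" for F
    using that T T'(1) unfolding perfect_tiling_def tiling_def by blast+
  have Fe: "\<exists>a\<in>A. \<exists>b\<in>B. e = {a, b}" if "F \<in> T'" "e \<in> edges F" for F e
    using F(1)[OF that(1)] that(2) GR unfolding subgraph_def balanced_bipartite_def by blast
  have disj: "verts F \<inter> verts F' = {}" if "F \<in> T'" "F' \<in> T'" "F \<noteq> F'" for F F'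
    using that T T'(1) unfolding perfect_tiling_def tiling_def by blast
  have copy: "card (verts F \<inter> A) = h" "card (verts F \<inter> B) = h"
    "\<And>a b. a \<in> verts F \<inter> A \<Longrightarrow> b \<in> verts F \<inter> B \<Longrightarrow> {a, b} \<in> edges F" if "F \<in> T'" for F
    using complete_bipartite_copy[OF F(2)[OF that] \<open>h \<ge> 1\<close> AB Fe[OF that]] by blast+
  define q where "q F = (verts F \<inter> A, verts F \<inter> B)" for F :: "'a ugraph"
  have ne: "verts F \<inter> A \<noteq> {}" if "F \<in> T'" for F
    using copy(1)[OF that] \<open>h \<ge> 1\<close> by auto
  have "inj_on q T'"
  proof (rule inj_onI, rule ccontr)
    fix F F' assume "F \<in> T'" "F' \<in> T'" "q F = q F'" "F \<noteq> F'"
    with disj[of F F'] ne[of F] show False unfolding q_def by blast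
  qed
  show thesis
  proof (rule that)
    show "q ` T' \<subseteq> {X. X \<subseteq> A \<and> card X = h} \<times> {Y. Y \<subseteq> B \<and> card Y = h}"
      using copy(1,2) by (auto simp: q_def)
    show "card (q ` T') = k"
      using T'(2) \<open>inj_on q T'\<close> by (simp add: card_image)
    show "\<forall>r\<in>q ` T'. \<forall>r'\<in>q ` T'. r \<noteq> r' \<longrightarrow> fst r \<inter> fst r' = {}"
    proof (intro ballI impI)
      fix r r' assume "r \<in> q ` T'" "r' \<in> q ` T'" "r \<noteq> r'"
      then obtain F F' where F: "F \<in> T'" "F' \<in> T'" "F \<noteq> F'" and r: "r = q F" "r' = q F'"
        by blast
      show "fst r \<inter> fst r' = {}"
        using disj[OF F] unfolding r q_def fst_conv by blast
    qed
    fix r a b assume "r \<in> q ` T'" "a \<in> fst r" "b \<in> snd r"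
    then obtain F where F': "F \<in> T'" "a \<in> verts F \<inter> A" "b \<in> verts F \<inter> B"
      by (auto simp: q_def)
    have "{a, b} \<in> edges (graph_union G R)"
      using copy(3)[OF F'] F(1)[OF F'(1)] unfolding subgraph_def by blast
    moreover have "{a, b} \<inter> Z = {}" using T'(3)[OF F'(1)] F' by blast
    ultimately show "{a, b} \<in> edges R"
      using dom unfolding graph_union_def by auto
  qed
qed

text \<open>There are at most \<open>n^(2h)\<close> positions for a copy, hence at most
  \<open>n^(2hk) / k!\<close> sets of \<open>k\<close> positions. A set of \<open>k\<close> disjoint
  positions is filled by random edges with probability \<open>p^(h*h*k)\<close>.\<close>

lemma prob_perfect_tiling_dominated_bipartite_le:
  assumes "h \<ge> 1" "0 \<le> p" "p \<le> 1" and k: "h * (k + 2 * m) \<le> n"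
  shows "measure_pmf.prob (random_bipartite {..<n} {n..<2 * n} p)
      {R. \<exists>T. perfect_tiling (complete_bipartite h h) (graph_union (dominated_bipartite n m) R) T}
    \<le> (real n ^ (2 * h) * p ^ (h * h)) ^ k / fact k"
proof -
  define A B where "A = {..<n}" and "B = {n..<2 * n}"
  have AB: "finite A" "finite B" "A \<inter> B = {}" "card A = n" "card B = n"
    by (auto simp: A_def B_def)
  define R where "R X = \<lparr>verts = A \<union> B, edges = {{a, b} | a b. a \<in> A \<and> b \<in> B \<and> X (a, b)}\<rparr>" for X
  define G where "G X = graph_union (dominated_bipartite n m) (R X)" for X
  \<comment> \<open>\<open>Q\<close> collects the possible positions of a copy, \<open>\<K>\<close>
    the \<open>k\<close>-sets of positions with disjoint traces on \<open>A\<close>, and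
    \<open>S K\<close> the random pairs that must be present for all positions in \<open>K\<close>
    to be filled.\<close>
  define Q where "Q = {X. X \<subseteq> A \<and> card X = h} \<times> {Y. Y \<subseteq> B \<and> card Y = h}"
  define \<K> where "\<K> = {K. K \<subseteq> Q \<and> card K = k \<and>
    (\<forall>q\<in>K. \<forall>q'\<in>K. q \<noteq> q' \<longrightarrow> fst q \<inter> fst q' = {})}"
  define S where "S K = (\<Union>q\<in>K. fst q \<times> snd q)" for K :: "(nat set \<times> nat set) set"
  have "finite Q" using AB by (simp add: Q_def)
  have cardQ: "card Q \<le> n ^ (2 * h)"
  proof -
    have "n choose h \<le> n ^ h"
      using binomial_fact_pow[of n h] mult_le_mono2[OF fact_ge_1[of h, where 'a = nat], of "n choose h"]
      by linarith
    then show ?thesis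
      using AB by (simp add: Q_def n_subsets card_cartesian_product mult_le_mono power_add mult_2)
  qed
  have "finite \<K>" using \<open>finite Q\<close> by (simp add: \<K>_def)
  have "card \<K> \<le> card {K. K \<subseteq> Q \<and> card K = k}"
    by (rule card_mono) (use \<open>finite Q\<close> in \<open>auto simp: \<K>_def\<close>)
  then have "card \<K> \<le> card Q choose k"
    using \<open>finite Q\<close> by (simp add: n_subsets)
  \<comment> \<open>Counting unordered families gains the factor \<open>fact k\<close>. For
    \<open>k\<close> linear in \<open>n\<close> it will outweigh the \<open>k\<close>-th power of a
    bound \<open>c * n\<close> on the mean number of copies.\<close>
  then have "card \<K> * fact k \<le> (card Q choose k) * fact k" by simp
  also have "\<dots> \<le> card Q ^ k" by (rule binomial_fact_pow)
  also have "\<dots> \<le> (n ^ (2 * h)) ^ k" using cardQ by (rule power_mono) simp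
  finally have "real (card \<K> * fact k) \<le> real ((n ^ (2 * h)) ^ k)"
    unfolding of_nat_le_iff .
  then have card\<K>: "real (card \<K>) \<le> (real n ^ (2 * h)) ^ k / fact k"
    by (simp add: pos_le_divide_eq)

  have cardS: "S K \<subseteq> A \<times> B \<and> card (S K) = h * h * k" if "K \<in> \<K>" for K
  proof
    have K: "K \<subseteq> Q" "card K = k" "\<And>q q'. q \<in> K \<Longrightarrow> q' \<in> K \<Longrightarrow> q \<noteq> q' \<Longrightarrow> fst q \<inter> fst q' = {}"
      using that unfolding \<K>_def by blast+
    have "finite K" using K(1) \<open>finite Q\<close> by (rule finite_subset)
    have q: "fst q \<subseteq> A" "snd q \<subseteq> B" "card (fst q) = h" "card (snd q) = h" if "q \<in> K" for q
      using subsetD[OF K(1) that] by (auto simp: Q_def mem_Times_iff)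
    from q(1,2) show "S K \<subseteq> A \<times> B" unfolding S_def by blast
    have "card (S K) = (\<Sum>q\<in>K. card (fst q \<times> snd q))"
      unfolding S_def
    proof (rule card_UN_disjoint)
      show "\<forall>q\<in>K. finite (fst q \<times> snd q)"
        using q(1,2) AB(1,2) by (meson finite_SigmaI finite_subset)
      show "\<forall>q\<in>K. \<forall>q'\<in>K. q \<noteq> q' \<longrightarrow> fst q \<times> snd q \<inter> fst q' \<times> snd q' = {}"
        using K(3) by blast
    qed (rule \<open>finite K\<close>)
    also have "\<dots> = (\<Sum>q\<in>K. h * h)"
      using q(3,4) by (intro sum.cong) (auto simp: card_cartesian_product)
    finally show "card (S K) = h * h * k" using K(2) by simp
  qed

  have tiles: "\<exists>K\<in>\<K>. \<forall>x\<in>S K. X x" if T: "perfect_tiling (complete_bipartite h h) (G X) T" for X T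
  proof -
    define Z where "Z = {..<m} \<union> {n..<n + m}"
    have D: "balanced_bipartite (dominated_bipartite n m) A B n"
      unfolding A_def B_def by (rule balanced_bipartite_dominated_bipartite)
    have RX: "\<exists>a\<in>A. \<exists>b\<in>B. e = {a, b} \<and> X (a, b)" if "e \<in> edges (R X)" for e
      using that unfolding R_def ugraph.simps mem_Collect_eq by blast
    then have "\<exists>a\<in>A. \<exists>b\<in>B. e = {a, b}" if "e \<in> edges (R X)" for e
      using that by blast
    with AB have RB: "balanced_bipartite (R X) A B n"
      by (intro balanced_bipartiteI) (simp_all add: R_def)
    have Z: "finite Z" "card Z \<le> 2 * m"
      unfolding Z_def using card_Un_le[of "{..<m}" "{n..<n + m}"] by simp_all
    have dom: "e \<inter> Z \<noteq> {}" if "e \<in> edges (dominated_bipartite n m)" for e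
      using that by (auto simp: dominated_bipartite_def Z_def)
    show ?thesis
    proof (rule perfect_tiling_imp_disjoint_copies[OF T[unfolded G_def] \<open>h \<ge> 1\<close> D RB Z dom k])
      fix K
      assume "K \<subseteq> {X. X \<subseteq> A \<and> card X = h} \<times> {Y. Y \<subseteq> B \<and> card Y = h}" "card K = k"
        "\<forall>q\<in>K. \<forall>q'\<in>K. q \<noteq> q' \<longrightarrow> fst q \<inter> fst q' = {}"
        and copies: "\<And>q a b. q \<in> K \<Longrightarrow> a \<in> fst q \<Longrightarrow> b \<in> snd q \<Longrightarrow> {a, b} \<in> edges (R X)"
      then have "K \<in> \<K>" by (simp add: \<K>_def Q_def)
      moreover have "X x" if "x \<in> S K" for x
      proof -
        from that obtain q a b where x: "x = (a, b)" "q \<in> K" "a \<in> fst q" "b \<in> snd q"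
          unfolding S_def by blast
        have "x \<in> A \<times> B" using cardS[OF \<open>K \<in> \<K>\<close>] that by blast
        then have "a \<in> A" "b \<in> B" by (simp_all add: x(1))
        \<comment> \<open>Edges are unordered, so the edge \<open>{a, b}\<close> only yields some
          pair \<open>(a', b')\<close> with \<open>X (a', b')\<close>; disjointness of
          \<open>A\<close> and \<open>B\<close> forces \<open>a' = a\<close> and
          \<open>b' = b\<close>.\<close>
        moreover obtain a' b' where "{a, b} = {a', b'}" "a' \<in> A" "b' \<in> B" "X (a', b')"
          using RX[OF copies[OF x(2-4)]] by blast
        ultimately show ?thesis
          unfolding x(1) using AB(3) by (metis IntI doubleton_eq_iff empty_iff)
      qed
      ultimately show ?thesis by blast
    qed
  qed

  have "measure_pmf.prob (random_bipartite A B p)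
      {R. \<exists>T. perfect_tiling (complete_bipartite h h) (graph_union (dominated_bipartite n m) R) T}
    = measure_pmf.prob (Pi_pmf (A \<times> B) False (\<lambda>_. bernoulli_pmf p))
      {X. \<exists>T. perfect_tiling (complete_bipartite h h) (G X) T}"
    by (simp add: random_bipartite_def vimage_def G_def R_def)
  also have "\<dots> \<le> measure_pmf.prob (Pi_pmf (A \<times> B) False (\<lambda>_. bernoulli_pmf p))
      {X. \<exists>s\<in>S ` \<K>. \<forall>x\<in>s. X x}"
    by (rule measure_pmf.finite_measure_mono) (use tiles in auto)
  also have "\<dots> \<le> real (card (S ` \<K>)) * p ^ (h * h * k)"
    by (rule prob_Pi_pmf_bernoulli_ex_all_le) (use AB \<open>finite \<K>\<close> cardS assms in auto)
  also have "\<dots> \<le> (real n ^ (2 * h)) ^ k / fact k * p ^ (h * h * k)"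
    using card_image_le[OF \<open>finite \<K>\<close>, of S] card\<K> \<open>0 \<le> p\<close> by (intro mult_right_mono) auto
  also have "\<dots> = (real n ^ (2 * h) * p ^ (h * h)) ^ k / fact k"
    by (simp add: power_mult power_mult_distrib)
  finally show ?thesis by (simp add: A_def B_def)
qed

section \<open>Numerical estimates at the edge density of the theorem\<close>

text \<open>By \<open>k! \<ge> (k / e)^k\<close> the left side is at most
  \<open>(e * x / k)^k\<close>, and the last assumption makes the base at most
  \<open>1 / 2\<close>.\<close>

lemma power_power_div_fact_le:
  assumes "0 \<le> x" "0 < k" "2 * exp 1 * x \<le> real k"
  shows "x ^ k / fact k \<le> (1 / 2) ^ k"
proof -
  have "(2 * exp 1 * x) ^ k \<le> real k ^ k"
    using assms by (intro power_mono) auto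
  also have "\<dots> \<le> exp 1 ^ k * fact k" by (rule power_self_le_exp_fact)
  finally have "2 ^ k * x ^ k \<le> fact k" by (simp add: power_mult_distrib)
  then show ?thesis by (simp add: field_simps)
qed

text \<open>The left side bounds the mean number of random copies of \<open>K_{h,h}\<close>.
  Multiplied by \<open>h * h\<close>, the exponent in the bound on \<open>p\<close> becomes
  \<open>1 - 2 * h\<close>, so the factor \<open>n^(2h)\<close> leaves exactly one power of
  \<open>n\<close>; \<open>c \<le> 1\<close> reduces \<open>c^(h*h)\<close> to
  \<open>c\<close>.\<close>

lemma copies_mean_le:
  fixes c p :: real
  assumes "h \<ge> 1" "n > 0" "0 < c" "c \<le> 1" "0 \<le> p"
    and p: "p \<le> c * real n powr (- (2 * real h - 1) / (real h)\<^sup>2)"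
  shows "real n ^ (2 * h) * p ^ (h * h) \<le> c * real n"
proof -
  have "p ^ (h * h) \<le> (c * real n powr (- (2 * real h - 1) / (real h)\<^sup>2)) ^ (h * h)"
    using p \<open>0 \<le> p\<close> by (rule power_mono)
  also have "\<dots> = c ^ (h * h) * real n powr (1 - 2 * real h)"
    using assms by (simp add: power_mult_distrib powr_power power2_eq_square)
  also have "\<dots> \<le> c * real n powr (1 - 2 * real h)"
    using assms power_decreasing[of 1 "h * h" c] by (intro mult_right_mono) auto
  finally have "real n ^ (2 * h) * p ^ (h * h) \<le> real n ^ (2 * h) * (c * real n powr (1 - 2 * real h))"
    by (rule mult_left_mono) simp
  also have "\<dots> = c * (real n powr (2 * real h) * real n powr (1 - 2 * real h))"
    using assms powr_realpow[of "real n" "2 * h"] by (simp add: mult_ac)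
  also have "\<dots> = c * real n"
    using assms by (simp add: powr_add[symmetric])
  finally show ?thesis .
qed

section \<open>Choice of the constants and passage to the limit\<close>

theorem theorem1p2:
  fixes \<alpha> :: real and h :: nat
  assumes "h \<ge> 1" and "\<alpha> \<in> {0<..<1 / (2 * real h)}"
  shows "\<exists>c>0. \<exists>(A :: nat \<Rightarrow> nat set) (B :: nat \<Rightarrow> nat set) (G :: nat \<Rightarrow> nat ugraph).
    (\<forall>n>0. h dvd n \<longrightarrow>
       balanced_bipartite (G n) (A n) (B n) n \<and> real (min_degree (G n)) \<ge> \<alpha> * real n) \<and>
    (\<forall>p :: nat \<Rightarrow> real.
       (\<forall>n>0. h dvd n \<longrightarrow>
          0 \<le> p n \<and> p n \<le> 1 \<and>
          p n \<le> c * real n powr (- (2 * real h - 1) / (real h)\<^sup>2)) \<longrightarrow>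
       ((\<lambda>n. measure_pmf.prob (random_bipartite (A n) (B n) (p n))
               {R. \<not> (\<exists>T. perfect_tiling (complete_bipartite h h) (graph_union (G n) R) T)})
          \<longlongrightarrow> 1) (inf sequentially (principal {n. h dvd n})))"
proof -
  \<comment> \<open>Up to rounding, \<open>\<epsilon> * n\<close> is the number of tiles left after
    removing \<open>2 * \<alpha> * n\<close> from \<open>n / h\<close>; it is positive as \<alpha> <
    1/(2h). Only a quarter of it is demanded as \<open>k n\<close>, which leaves room for the
    ceilings. The value of \<open>c\<close> makes \<open>2 * exp 1 * c * n\<close> equal to
    \<open>\<epsilon> * n / 4\<close>, hence at most \<open>k n\<close>.\<close>
  define \<epsilon> where "\<epsilon> = 1 / real h - 2 * \<alpha>"
  define c where "c = \<epsilon> / (8 * exp 1)"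
  define k where "k n = nat \<lceil>\<epsilon> * real n / 4\<rceil>" for n
  define m where "m n = nat \<lceil>\<alpha> * real n\<rceil>" for n
  have h: "real h \<ge> 1" using assms by simp
  have \<alpha>: "0 < \<alpha>" "2 * \<alpha> < 1 / real h" using assms by (auto simp: field_simps)
  moreover have "1 / real h \<le> 1" using h by (simp add: field_simps)
  ultimately have \<epsilon>: "0 < \<epsilon>" "\<epsilon> \<le> 1" and "\<alpha> \<le> 1" by (auto simp: \<epsilon>_def)
  have "8 * exp (1::real) \<ge> 1" using exp_ge_add_one_self[of 1] by simp
  then have c: "0 < c" "c \<le> 1" using \<epsilon> by (auto simp: c_def)
  have m: "\<alpha> * real n \<le> real (m n)" "real (m n) \<le> \<alpha> * real n + 1" "m n \<le> n" for n
  proof -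
    have "0 \<le> \<alpha> * real n" using \<alpha> by simp
    then show "\<alpha> * real n \<le> real (m n)" "real (m n) \<le> \<alpha> * real n + 1"
      unfolding m_def by linarith+
    have "\<alpha> * real n \<le> real n" using \<alpha> \<open>\<alpha> \<le> 1\<close> by (simp add: mult_left_le_one_le)
    then show "m n \<le> n" unfolding m_def by (simp add: ceiling_le_iff)
  qed
  have k: "\<epsilon> * real n / 4 \<le> real (k n)" "real (k n) \<le> \<epsilon> * real n / 4 + 1" for n
  proof -
    have "0 \<le> \<epsilon> * real n / 4" using \<epsilon> by simp
    then show "\<epsilon> * real n / 4 \<le> real (k n)" "real (k n) \<le> \<epsilon> * real n / 4 + 1"
      unfolding k_def by linarith+
  qed
  have "((\<lambda>n. measure_pmf.prob (random_bipartite {..<n} {n..<2 * n} (p n))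
        {R. \<not> (\<exists>T. perfect_tiling (complete_bipartite h h) (graph_union (dominated_bipartite n (m n)) R) T)})
      \<longlongrightarrow> 1) (inf sequentially (principal {n. h dvd n}))"
    (is "(?P \<longlongrightarrow> 1) ?F")
    if p: "\<forall>n>0. h dvd n \<longrightarrow> 0 \<le> p n \<and> p n \<le> 1 \<and>
        p n \<le> c * real n powr (- (2 * real h - 1) / (real h)\<^sup>2)"
    for p
  proof (rule tendsto_sandwich)
    have bound: "?P n \<ge> 1 - (1 / 2) ^ k n" if n: "n \<ge> nat \<lceil>4 / \<epsilon>\<rceil>" "n > 0" "h dvd n" for n
    proof -
      let ?E = "{R. \<exists>T. perfect_tiling (complete_bipartite h h) (graph_union (dominated_bipartite n (m n)) R) T}"
      have pn: "0 \<le> p n" "p n \<le> 1" "p n \<le> c * real n powr (- (2 * real h - 1) / (real h)\<^sup>2)"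
        using p n by auto
      \<comment> \<open>Rounding costs at most 1 in \<open>k n\<close> and 2 in
        \<open>2 * m n\<close>. This total of 3 fits into the spare
        \<open>3 * \<epsilon> * n / 4\<close> once \<open>\<epsilon> * n \<ge> 4\<close>.\<close>
      have "4 / \<epsilon> \<le> real n" using n by linarith
      then have "4 \<le> \<epsilon> * real n" using \<epsilon> by (simp add: field_simps)
      then have "real (k n) + 2 * real (m n) \<le> \<epsilon> * real n + 2 * \<alpha> * real n"
        using k(2)[of n] m(2)[of n] by linarith
      also have "\<dots> = real n / real h" by (simp add: \<epsilon>_def algebra_simps)
      finally have "real h * (real (k n) + 2 * real (m n)) \<le> real n"
        using h by (simp add: field_simps)
      then have "real (h * (k n + 2 * m n)) \<le> real n" by simp
      then have "h * (k n + 2 * m n) \<le> n" unfolding of_nat_le_iff .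
      then have "measure_pmf.prob (random_bipartite {..<n} {n..<2 * n} (p n)) ?E
          \<le> (real n ^ (2 * h) * p n ^ (h * h)) ^ k n / fact (k n)"
        using prob_perfect_tiling_dominated_bipartite_le assms(1) pn by blast
      also have "\<dots> \<le> (1 / 2) ^ k n"
      proof (rule power_power_div_fact_le)
        show "0 < k n" using k(1)[of n] \<open>4 \<le> \<epsilon> * real n\<close> by linarith
        have "2 * exp 1 * (real n ^ (2 * h) * p n ^ (h * h)) \<le> 2 * exp 1 * (c * real n)"
          using copies_mean_le[OF assms(1) n(2) c pn(1,3)] by (intro mult_left_mono) auto
        also have "\<dots> = \<epsilon> * real n / 4" by (simp add: c_def)
        finally show "2 * exp 1 * (real n ^ (2 * h) * p n ^ (h * h)) \<le> real (k n)"
          using k(1)[of n] by linarith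
      qed (use pn in simp)
      finally have "measure_pmf.prob (random_bipartite {..<n} {n..<2 * n} (p n)) ?E \<le> (1 / 2) ^ k n" .
      moreover have "?P n = 1 - measure_pmf.prob (random_bipartite {..<n} {n..<2 * n} (p n)) ?E"
        by (subst measure_pmf.prob_compl[symmetric]) (auto intro: arg_cong2[where f = measure])
      ultimately show ?thesis by linarith
    qed
    show "\<forall>\<^sub>F n in ?F. 1 - (1 / 2) ^ k n \<le> ?P n"
      unfolding eventually_inf_principal
      using eventually_ge_at_top[of "nat \<lceil>4 / \<epsilon>\<rceil>"] eventually_gt_at_top[of 0]
      by eventually_elim (use bound in blast)
    have "filterlim (\<lambda>n. real (k n)) at_top sequentially"
    proof (rule filterlim_at_top_mono)
      show "filterlim (\<lambda>n. \<epsilon> / 4 * real n) at_top sequentially"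
        using \<epsilon> by (intro filterlim_tendsto_pos_mult_at_top[OF tendsto_const] filterlim_real_sequentially) simp
    qed (use k(1) in simp)
    then have "filterlim k at_top sequentially"
      by (simp add: filterlim_sequentially_iff_filterlim_real)
    then have "(\<lambda>n. (1 / 2 :: real) ^ k n) \<longlonglongrightarrow> 0"
      by (rule filterlim_compose[rotated]) (simp add: LIMSEQ_realpow_zero)
    then have "(\<lambda>n. 1 - (1 / 2 :: real) ^ k n) \<longlonglongrightarrow> 1 - 0"
      by (intro tendsto_diff tendsto_const)
    \<comment> \<open>A limit along all \<open>n\<close> persists under the finer filter of
      multiples of \<open>h\<close>.\<close>
    then show "((\<lambda>n. 1 - (1 / 2 :: real) ^ k n) \<longlongrightarrow> 1) ?F"
      using tendsto_mono[OF inf_le1] by simp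
  qed (auto intro!: always_eventually measure_pmf.prob_le_1)
  moreover have "\<alpha> * real n \<le> real (min_degree (dominated_bipartite n (m n)))" if "n > 0" for n
    using min_degree_dominated_bipartite[OF that m(3)] m(1)[of n] by (meson of_nat_mono order_trans)
  ultimately show ?thesis
    using c(1) balanced_bipartite_dominated_bipartite
    by - (rule exI[of _ c], rule conjI, assumption, rule exI[of _ "\<lambda>n. {..<n}"],
      rule exI[of _ "\<lambda>n. {n..<2 * n}"], rule exI[of _ "\<lambda>n. dominated_bipartite n (m n)"], blast)
qed

end
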